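(* Let $\mathcal O$ be an open subset of $\mathbb R^2$, $(X_1,X_2):\mathcal O\to\mathbb R^m\times\mathbb R^m$ a $2$-tuple in $\mathbb R^m$ of type $O(2)$, and $(x_1,x_2)\in\mathcal O$ spherical line of curvature coordinates. Then $$K_2(x)=-K_1(x),$$ where $K_1,K_2$ are respectively the Gaussian curvatures of $X_1,X_2$.
   Context: $2$-tuple of type $O(2)$: let $m>2$, $\mathcal O$ a domain in $\mathbb R^2$, and $X_1,X_2:\mathcal O\to\mathbb R^m$ immersions with flat and non-degenerate normal bundle. $(X_1,X_2)$ is a $2$-tuple in $\mathbb R^m$ of type $O(2)$ if (i) the normal planes of $X_1(x)$ and $X_2(x)$ are parallel for all $x\in\mathcal O$; (ii) there exists a common parallel normal frame $e_3,\dots,e_m$; (iii) $x\in\mathcal O$ is a spherical line of curvature coordinate system with respect to $\{e_\alpha\}$ for each $X_j$, such that the fundamental forms of $X_j$ are $$I_j=\sum_{i=1}^2b_{ji}^2\,dx_i^2,\qquad II_j=\sum_{i=1}^2\sum_{k=1}^{m-2}b_{ji}g_{ki}\,dx_i^2\,e_{2+k}$$ for some $O(2)$-valued map $B=(b_{ij})$ and some map $G=(g_{ij})$ into the real $(m-2)\times2$ matrices. The normal bundle of a surface is non-degenerate if at each point the space of shape operators $\{A_v:v\text{ normal}\}$ has dimension $2$. Line of curvature coordinates with respect to an orthonormal parallel normal frame are coordinates with $I=\sum_ia_i^2dx_i^2$ and $II=\sum_{i,j}c_{ji}dx_i^2e_{2+j}$; spherical means in addition $a_1^2+a_2^2=1$.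 Convention: $I=\sum\omega_i^2$, $II=\sum_{i,\alpha}\omega_{i\alpha}\omega_ie_\alpha$ with $\omega_i=\langle dX,e_i\rangle$, $\omega_{i\alpha}=\langle e_i,de_\alpha\rangle$. *)

theory Defs
  imports "HOL-Analysis.Analysis"
begin

text \<open>\<open>Ck_on k S f\<close>, for open \<open>S\<close>: all iterated directional derivatives of \<open>f\<close> up to order
  \<open>k\<close> exist (as Frechet derivatives) and are continuous on \<open>S\<close>.\<close>

primrec Ck_on :: "nat \<Rightarrow> 'a::euclidean_space set \<Rightarrow> ('a \<Rightarrow> 'b::real_normed_vector) \<Rightarrow> bool" where
  "Ck_on 0 S f \<longleftrightarrow> continuous_on S f"
| "Ck_on (Suc k) S f \<longleftrightarrow>
     (\<forall>x\<in>S. f differentiable (at x)) \<and> (\<forall>v. Ck_on k S (\<lambda>x. frechet_derivative f (at x) v))"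

definition smooth_on :: "'a::euclidean_space set \<Rightarrow> ('a \<Rightarrow> 'b::real_normed_vector) \<Rightarrow> bool" where
  "smooth_on S f \<longleftrightarrow> (\<forall>k. Ck_on k S f)"

definition pd :: "2 \<Rightarrow> (real^2 \<Rightarrow> 'b::real_normed_vector) \<Rightarrow> real^2 \<Rightarrow> 'b" where
  "pd i f x = frechet_derivative f (at x) (axis i 1)"

definition immersion_on :: "(real^2) set \<Rightarrow> (real^2 \<Rightarrow> real^'m) \<Rightarrow> bool" where
  "immersion_on S X \<longleftrightarrow> smooth_on S X \<and> (\<forall>x\<in>S. inj (frechet_derivative X (at x)))"

definition normal_space :: "(real^2 \<Rightarrow> real^'m) \<Rightarrow> real^2 \<Rightarrow> (real^'m) set" where
  "normal_space X x = orthogonal_comp (range (frechet_derivative X (at x)))"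

definition normal_field_on ::
    "(real^2) set \<Rightarrow> (real^2 \<Rightarrow> real^'m) \<Rightarrow> (real^2 \<Rightarrow> real^'m) \<Rightarrow> bool" where
  "normal_field_on S X \<xi> \<longleftrightarrow> smooth_on S \<xi> \<and> (\<forall>x\<in>S. \<xi> x \<in> normal_space X x)"

text \<open>The normal connection: orthogonal projection (nearest point) of the derivative of \<open>\<xi>\<close> in
  the constant direction \<open>w\<close> onto the normal space.\<close>

definition normal_deriv ::
    "(real^2 \<Rightarrow> real^'m) \<Rightarrow> (real^2 \<Rightarrow> real^'m) \<Rightarrow> real^2 \<Rightarrow> real^2 \<Rightarrow> real^'m" where
  "normal_deriv X \<xi> w x = closest_point (normal_space X x) (frechet_derivative \<xi> (at x) w)"

text \<open>Vanishing of the curvature of the normal connection; there is no bracket term because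
  constant vector fields on the parameter domain commute.\<close>

definition flat_normal_bundle :: "(real^2) set \<Rightarrow> (real^2 \<Rightarrow> real^'m) \<Rightarrow> bool" where
  "flat_normal_bundle S X \<longleftrightarrow>
     (\<forall>\<xi>. normal_field_on S X \<xi> \<longrightarrow> (\<forall>u w. \<forall>x\<in>S.
        normal_deriv X (normal_deriv X \<xi> w) u x = normal_deriv X (normal_deriv X \<xi> u) w x))"

definition metric_matrix :: "(real^2 \<Rightarrow> real^'m) \<Rightarrow> real^2 \<Rightarrow> real^2^2" where
  "metric_matrix X x = (\<chi> i j. pd i X x \<bullet> pd j X x)"

text \<open>The matrix, in the coordinate basis of the tangent space, of the shape operator \<open>A\<^sub>v\<close>.
  Its sign follows the convention \<open>II = \<Sum> \<omega>\<^sub>i\<^sub>\<alpha> \<omega>\<^sub>i e\<^sub>\<alpha>\<close> with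
  \<open>\<omega>\<^sub>i\<^sub>\<alpha> = \<langle>e\<^sub>i, de\<^sub>\<alpha>\<rangle>\<close>, that is \<open>\<langle>II(u,w), \<xi>\<rangle> = \<langle>dX(u), d\<xi>(w)\<rangle> = - \<langle>D\<^sup>2X(u,w), \<xi>\<rangle>\<close>
  for normal fields \<open>\<xi>\<close>.\<close>

definition shape_operator :: "(real^2 \<Rightarrow> real^'m) \<Rightarrow> real^2 \<Rightarrow> real^'m \<Rightarrow> real^2^2" where
  "shape_operator X x v = matrix_inv (metric_matrix X x) ** (\<chi> i j. - (pd i (pd j X) x \<bullet> v))"

definition nondegenerate_normal_bundle :: "(real^2) set \<Rightarrow> (real^2 \<Rightarrow> real^'m) \<Rightarrow> bool" where
  "nondegenerate_normal_bundle S X \<longleftrightarrow>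
     (\<forall>x\<in>S. dim (shape_operator X x ` normal_space X x) = 2)"

text \<open>Normal frames \<open>e\<^sub>3, \<dots>, e\<^sub>m\<close> are families indexed by \<open>nat\<close>, of which only the indices
  \<open>3, \<dots>, m = CARD('m)\<close> matter.\<close>

definition parallel_normal_frame ::
    "(real^2) set \<Rightarrow> (real^2 \<Rightarrow> real^'m) \<Rightarrow> (nat \<Rightarrow> real^2 \<Rightarrow> real^'m) \<Rightarrow> bool" where
  "parallel_normal_frame S X e \<longleftrightarrow>
     (\<forall>\<alpha>\<in>{3..CARD('m)}. normal_field_on S X (e \<alpha>)) \<and>
     (\<forall>x\<in>S. \<forall>\<alpha>\<in>{3..CARD('m)}. \<forall>\<beta>\<in>{3..CARD('m)}. e \<alpha> x \<bullet> e \<beta> x = of_bool (\<alpha> = \<beta>)) \<and>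
     (\<forall>x\<in>S. \<forall>\<alpha>\<in>{3..CARD('m)}. \<forall>w. normal_deriv X (e \<alpha>) w x = 0)"

definition first_form :: "(real^2 \<Rightarrow> real^'m) \<Rightarrow> real^2 \<Rightarrow> real^2 \<Rightarrow> real^2 \<Rightarrow> real" where
  "first_form X x u w = frechet_derivative X (at x) u \<bullet> frechet_derivative X (at x) w"

text \<open>\<open>II = \<Sum> \<omega>\<^sub>i \<omega>\<^sub>i\<^sub>\<alpha> e\<^sub>\<alpha>\<close>, where the sum over an orthonormal tangent frame \<open>e\<^sub>i\<close> has been
  carried out: \<open>\<Sum> \<omega>\<^sub>i(u) \<omega>\<^sub>i\<^sub>\<alpha>(w) = \<Sum> \<langle>dX(u), e\<^sub>i\<rangle> \<langle>e\<^sub>i, de\<^sub>\<alpha>(w)\<rangle> = \<langle>dX(u), de\<^sub>\<alpha>(w)\<rangle>\<close>.\<close>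

definition second_form ::
    "(real^2 \<Rightarrow> real^'m) \<Rightarrow> (nat \<Rightarrow> real^2 \<Rightarrow> real^'m) \<Rightarrow> real^2 \<Rightarrow> real^2 \<Rightarrow> real^2 \<Rightarrow> real^'m" where
  "second_form X e x u w = (\<Sum>\<alpha>=3..CARD('m).
     (frechet_derivative X (at x) u \<bullet> frechet_derivative (e \<alpha>) (at x) w) *\<^sub>R e \<alpha> x)"

text \<open>The standard coordinates of the parameter domain are spherical line of curvature coordinates:
  \<open>I = \<Sum> a\<^sub>i\<^sup>2 dx\<^sub>i\<^sup>2\<close>, \<open>II = \<Sum> c\<^sub>k\<^sub>i dx\<^sub>i\<^sup>2 e\<^bsub>2+k\<^esub>\<close> (stated for the associated bilinear forms) and
  \<open>a\<^sub>1\<^sup>2 + a\<^sub>2\<^sup>2 = 1\<close>.\<close>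

definition spherical_line_of_curvature_coordinates ::
    "(real^2) set \<Rightarrow> (real^2 \<Rightarrow> real^'m) \<Rightarrow> (nat \<Rightarrow> real^2 \<Rightarrow> real^'m) \<Rightarrow>
     (real^2 \<Rightarrow> 2 \<Rightarrow> real) \<Rightarrow> (real^2 \<Rightarrow> nat \<Rightarrow> 2 \<Rightarrow> real) \<Rightarrow> bool" where
  "spherical_line_of_curvature_coordinates S X e a c \<longleftrightarrow> (\<forall>x\<in>S.
     (\<forall>u w. first_form X x u w = (\<Sum>i\<in>UNIV. (a x i)\<^sup>2 * (u $ i * w $ i))) \<and>
     (\<forall>u w. second_form X e x u w =
        (\<Sum>i\<in>UNIV. \<Sum>k=1..CARD('m) - 2. (c x k i * (u $ i * w $ i)) *\<^sub>R e (2 + k) x)) \<and>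
     (a x 1)\<^sup>2 + (a x 2)\<^sup>2 = 1)"

text \<open>\<open>g x k i\<close> is the \<open>(k,i)\<close> entry of the \<open>(m-2) \<times> 2\<close> matrix \<open>G\<close>; only \<open>k = 1, \<dots>, m-2\<close>
  matter.\<close>

definition two_tuple_O2 ::
    "(real^2) set \<Rightarrow> (real^2 \<Rightarrow> real^'m) \<Rightarrow> (real^2 \<Rightarrow> real^'m) \<Rightarrow> bool" where
  "two_tuple_O2 S X1 X2 \<longleftrightarrow>
     immersion_on S X1 \<and> flat_normal_bundle S X1 \<and> nondegenerate_normal_bundle S X1 \<and>
     immersion_on S X2 \<and> flat_normal_bundle S X2 \<and> nondegenerate_normal_bundle S X2 \<and>
     (\<forall>x\<in>S. normal_space X1 x = normal_space X2 x) \<and>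
     (\<exists>e. parallel_normal_frame S X1 e \<and> parallel_normal_frame S X2 e \<and>
       (\<exists>(B :: real^2 \<Rightarrow> real^2^2) (g :: real^2 \<Rightarrow> nat \<Rightarrow> 2 \<Rightarrow> real).
          (\<forall>x\<in>S. orthogonal_matrix (B x)) \<and>
          spherical_line_of_curvature_coordinates S X1 e
            (\<lambda>x i. B x $ 1 $ i) (\<lambda>x k i. B x $ 1 $ i * g x k i) \<and>
          spherical_line_of_curvature_coordinates S X2 e
            (\<lambda>x i. B x $ 2 $ i) (\<lambda>x k i. B x $ 2 $ i * g x k i)))"

text \<open>Gaussian curvature is the intrinsic (sectional) curvature of the induced metric.
  \<open>christoffel X k i j\<close> is \<open>\<Gamma>\<^sup>k\<^sub>i\<^sub>j\<close>, and \<open>riemann X l i j k\<close> is the \<open>\<partial>\<^sub>l\<close>-component of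
  \<open>R(\<partial>\<^sub>i,\<partial>\<^sub>j)\<partial>\<^sub>k\<close>, with \<open>R(u,v) = \<nabla>\<^sub>u\<nabla>\<^sub>v - \<nabla>\<^sub>v\<nabla>\<^sub>u - \<nabla>\<^bsub>[u,v]\<^esub>\<close>.\<close>

definition christoffel :: "(real^2 \<Rightarrow> real^'m) \<Rightarrow> 2 \<Rightarrow> 2 \<Rightarrow> 2 \<Rightarrow> real^2 \<Rightarrow> real" where
  "christoffel X k i j x = (\<Sum>l\<in>UNIV. matrix_inv (metric_matrix X x) $ k $ l *
     (pd i (\<lambda>y. metric_matrix X y $ j $ l) x + pd j (\<lambda>y. metric_matrix X y $ i $ l) x
       - pd l (\<lambda>y. metric_matrix X y $ i $ j) x)) / 2"

definition riemann :: "(real^2 \<Rightarrow> real^'m) \<Rightarrow> 2 \<Rightarrow> 2 \<Rightarrow> 2 \<Rightarrow> 2 \<Rightarrow> real^2 \<Rightarrow> real" where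
  "riemann X l i j k x =
     pd i (christoffel X l j k) x - pd j (christoffel X l i k) x
     + (\<Sum>p\<in>UNIV. christoffel X p j k x * christoffel X l i p x
                   - christoffel X p i k x * christoffel X l j p x)"

definition gaussian_curvature :: "(real^2 \<Rightarrow> real^'m) \<Rightarrow> real^2 \<Rightarrow> real" where
  "gaussian_curvature X x =
     (\<Sum>l\<in>UNIV. metric_matrix X x $ 1 $ l * riemann X l 1 2 2 x) / det (metric_matrix X x)"

end

theory Submission
  imports Defs
begin

text \<open>The proof is intrinsic. In coordinates with \<open>I = E dx\<^sub>1\<^sup>2 + G dx\<^sub>2\<^sup>2\<close> the curvature is the
  expression in \<open>E\<close>, \<open>G\<close> and their derivatives given in \<open>gaussian_curvature_orthogonal\<close>. For a
  tuple of type \<open>O(2)\<close> the columns of \<open>B\<close> are unit vectors, so the two metrics are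
  \<open>E dx\<^sub>1\<^sup>2 + (1 - E) dx\<^sub>2\<^sup>2\<close> and \<open>(1 - E) dx\<^sub>1\<^sup>2 + E dx\<^sub>2\<^sup>2\<close> with the same \<open>E\<close>, and replacing
  \<open>E\<close> by \<open>1 - E\<close> changes the sign of
  \<open>K = (E\<^sub>1\<^sub>1 - E\<^sub>2\<^sub>2) / (2 E G) + (E\<^sub>1\<^sup>2 - E\<^sub>2\<^sup>2) / (4 E G) (1/G - 1/E)\<close>, where \<open>G = 1 - E\<close>.\<close>

section \<open>Calculus of the coordinate derivatives \<open>pd\<close>\<close>

lemma has_derivative_imp_pd:
  assumes "(f has_derivative f') (at x)"
  shows "pd i f x = f' (axis i 1)"
  using frechet_derivative_at[OF assms] by (simp add: pd_def)

lemma pd_const: "pd i (\<lambda>_. c) x = 0"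
  using has_derivative_imp_pd[OF has_derivative_const] .

text \<open>On an open set both functions admit exactly the same derivatives at \<open>x\<close>, so
  the choice operator in \<open>frechet_derivative\<close> returns the same map for both.\<close>

lemma pd_cong:
  assumes "open S" "x \<in> S" "\<And>y. y \<in> S \<Longrightarrow> f y = g y"
  shows "pd i f x = pd i g x"
proof -
  have "(f has_derivative f') (at x) \<longleftrightarrow> (g has_derivative f') (at x)" for f'
    using has_derivative_transform_within_open[OF _ assms(1,2), of f f' UNIV g]
      has_derivative_transform_within_open[OF _ assms(1,2), of g f' UNIV f] assms(3) by auto
  then show ?thesis
    by (simp add: pd_def frechet_derivative_def)
qed

lemma differentiable_cong_open:
  assumes "f differentiable (at x)" "open S" "x \<in> S" "\<And>y. y \<in> S \<Longrightarrow> f y = g y"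
  shows "g differentiable (at x)"
  using has_derivative_transform_within_open[OF _ assms(2,3), of f _ UNIV g] assms(1,4)
  unfolding differentiable_def by blast

lemma pd_inner:
  assumes "f differentiable (at x)" "g differentiable (at x)"
  shows "pd i (\<lambda>y. f y \<bullet> g y) x = f x \<bullet> pd i g x + pd i f x \<bullet> g x"
  using has_derivative_imp_pd[OF has_derivative_inner[OF
        assms[unfolded frechet_derivative_works]]]
  by (simp add: pd_def)

lemma pd_diff_const:
  assumes "f differentiable (at x)"
  shows "pd i (\<lambda>y. c - f y) x = - pd i f x"
  using has_derivative_imp_pd[OF has_derivative_diff[OF has_derivative_const
        assms[unfolded frechet_derivative_works]]]
  by (simp add: pd_def)

lemma pd_minus:
  assumes "f differentiable (at x)"
  shows "pd i (\<lambda>y. - f y) x = - pd i f x"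
  using pd_diff_const[OF assms, of i 0] by simp

lemma pd_divide:
  fixes f g :: "real^2 \<Rightarrow> real"
  assumes "f differentiable (at x)" "g differentiable (at x)" "g x \<noteq> 0"
  shows "pd i (\<lambda>y. f y / g y) x = (pd i f x * g x - f x * pd i g x) / (g x * g x)"
  using has_derivative_imp_pd[OF has_derivative_divide'[OF
        assms(1,2)[unfolded frechet_derivative_works] assms(3)]]
  by (simp add: pd_def)

section \<open>Regularity and positivity of the metric coefficients\<close>

lemma smooth_on_imp_differentiable:
  assumes "smooth_on S f" "x \<in> S"
  shows "f differentiable (at x)"
proof -
  have "Ck_on (Suc 0) S f"
    using assms(1) unfolding smooth_on_def by blast
  then show ?thesis
    using assms(2) by simp
qed

lemma smooth_on_pd:
  assumes "smooth_on S f"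
  shows "smooth_on S (pd i f)"
  unfolding smooth_on_def
proof
  fix k
  have "Ck_on (Suc k) S f"
    using assms unfolding smooth_on_def by blast
  then show "Ck_on k S (pd i f)"
    by (simp add: pd_def[abs_def])
qed

lemma metric_matrix_differentiable:
  assumes "smooth_on S X" "x \<in> S"
  shows "(\<lambda>y. metric_matrix X y $ i $ j) differentiable (at x)"
  using assms by (simp add: metric_matrix_def
      smooth_on_imp_differentiable[of S] smooth_on_pd)

text \<open>The product rule, valid on all of \<open>S\<close>, writes this function through first
  and second derivatives of \<open>X\<close>, which are again smooth.\<close>

lemma pd_metric_matrix_differentiable:
  assumes "open S" "smooth_on S X" "x \<in> S"
  shows "pd k (\<lambda>y. metric_matrix X y $ i $ j) differentiable (at x)"
proof (rule differentiable_cong_open[OF _ assms(1,3)])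
  show "(\<lambda>y. pd i X y \<bullet> pd k (pd j X) y + pd k (pd i X) y \<bullet> pd j X y) differentiable (at x)"
    using assms by (intro differentiable_add differentiable_inner
        smooth_on_imp_differentiable[of S] smooth_on_pd)
  show "pd i X y \<bullet> pd k (pd j X) y + pd k (pd i X) y \<bullet> pd j X y
      = pd k (\<lambda>y. metric_matrix X y $ i $ j) y" if "y \<in> S" for y
    using assms(2) that by (simp add: metric_matrix_def pd_inner
        smooth_on_imp_differentiable[of S] smooth_on_pd)
qed

text \<open>The entry is the squared length of \<open>pd i X x\<close>, the image of a nonzero
  vector under an injective linear map.\<close>

lemma metric_matrix_diagonal_pos:
  assumes "immersion_on S X" "x \<in> S"
  shows "metric_matrix X x $ i $ i > 0"
proof -
  have "linear (frechet_derivative X (at x))" "inj (frechet_derivative X (at x))"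
    using assms smooth_on_imp_differentiable linear_frechet_derivative
    unfolding immersion_on_def by blast+
  then have "pd i X x \<noteq> 0"
    unfolding pd_def by (metis axis_eq_0_iff linear_injective_0 zero_neq_one)
  then show ?thesis
    by (simp add: metric_matrix_def)
qed

lemma metric_matrix_eq_first_form:
  "metric_matrix X x $ i $ j = first_form X x (axis i 1) (axis j 1)"
  by (simp add: metric_matrix_def first_form_def pd_def)

section \<open>Curvature of a diagonal metric\<close>

lemma matrix_inv_diagonal_2:
  fixes A :: "real^2^2"
  assumes "A $ 1 $ 2 = 0" "A $ 2 $ 1 = 0" "A $ 1 $ 1 \<noteq> 0" "A $ 2 $ 2 \<noteq> 0"
  shows "matrix_inv A $ 1 $ 1 = 1 / A $ 1 $ 1" "matrix_inv A $ 1 $ 2 = 0"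
    "matrix_inv A $ 2 $ 1 = 0" "matrix_inv A $ 2 $ 2 = 1 / A $ 2 $ 2"
proof -
  define D :: "real^2^2" where "D = (\<chi> i j. if i = j then 1 / A $ i $ i else 0)"
  have D: "A ** D = mat 1" "D ** A = mat 1"
    using assms by (simp_all add: D_def matrix_matrix_mult_def mat_def vec_eq_iff forall_2 sum_2)
  \<comment> \<open>\<open>matrix_inv\<close> is a choice among two-sided inverses, so uniqueness is
    what identifies it with \<open>D\<close>.\<close>
  have unique: "A' = D" if "A ** A' = mat 1" for A'
  proof -
    have "A' = (D ** A) ** A'"
      by (simp only: D(2) matrix_mul_lid)
    also have "\<dots> = D"
      by (simp only: that matrix_mul_assoc[symmetric] matrix_mul_rid)
    finally show ?thesis .
  qed
  have "matrix_inv A = D"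
    unfolding matrix_inv_def by (rule some_equality) (use D unique in blast)+
  then show "matrix_inv A $ 1 $ 1 = 1 / A $ 1 $ 1" "matrix_inv A $ 1 $ 2 = 0"
    "matrix_inv A $ 2 $ 1 = 0" "matrix_inv A $ 2 $ 2 = 1 / A $ 2 $ 2"
    by (simp_all add: D_def)
qed

text \<open>This is the classical \<open>K = - ((G_1 / sqrt (E G))_1 + (E_2 / sqrt (E G))_2) / (2
  sqrt (E G))\<close>, expanded so that no roots remain. It is invariant under exchanging
  \<open>E\<close> with \<open>G\<close> and direction 1 with 2.\<close>

lemma gaussian_curvature_orthogonal:
  fixes S :: "(real^2) set" and X :: "real^2 \<Rightarrow> real^'m"
  defines "E \<equiv> \<lambda>y. metric_matrix X y $ 1 $ 1" and "G \<equiv> \<lambda>y. metric_matrix X y $ 2 $ 2"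
  assumes "open S" "immersion_on S X" "x \<in> S"
    and offdiag: "\<And>y. y \<in> S \<Longrightarrow> metric_matrix X y $ 1 $ 2 = 0"
  shows "gaussian_curvature X x =
    - (pd 1 (pd 1 G) x + pd 2 (pd 2 E) x) / (2 * E x * G x)
    + (pd 1 E x * pd 1 G x + (pd 2 E x)\<^sup>2) / (4 * (E x)\<^sup>2 * G x)
    + (pd 2 E x * pd 2 G x + (pd 1 G x)\<^sup>2) / (4 * E x * (G x)\<^sup>2)"
proof -
  have smooth: "smooth_on S X"
    using assms(4) by (simp add: immersion_on_def)
  have offdiag': "metric_matrix X y $ 2 $ 1 = 0" if "y \<in> S" for y
    using offdiag[OF that] by (simp add: metric_matrix_def inner_commute)
  have pos: "E y > 0" "G y > 0" if "y \<in> S" for y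
    using metric_matrix_diagonal_pos[OF assms(4) that] by (simp_all add: E_def G_def)
  have diff: "E differentiable (at y)" "G differentiable (at y)"
    "pd i E differentiable (at y)" "pd i G differentiable (at y)" if "y \<in> S" for y i
    unfolding E_def G_def using that smooth assms(3)
    by (auto intro: metric_matrix_differentiable pd_metric_matrix_differentiable)
  have pd_offdiag: "pd i (\<lambda>y. metric_matrix X y $ 1 $ 2) y = 0"
    "pd i (\<lambda>y. metric_matrix X y $ 2 $ 1) y = 0" if "y \<in> S" for i y
    using pd_cong[OF assms(3) that, of _ "\<lambda>_. 0 :: real" i] offdiag offdiag'
    by (simp_all add: pd_const)
  have inv: "matrix_inv (metric_matrix X y) $ 1 $ 1 = 1 / E y"
    "matrix_inv (metric_matrix X y) $ 1 $ 2 = 0" "matrix_inv (metric_matrix X y) $ 2 $ 1 = 0"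
    "matrix_inv (metric_matrix X y) $ 2 $ 2 = 1 / G y" if "y \<in> S" for y
    using matrix_inv_diagonal_2[of "metric_matrix X y"] offdiag[OF that] offdiag'[OF that] pos[OF that]
    by (simp_all add: E_def G_def)
  \<comment> \<open>These are the six symbols occurring in \<open>riemann X 1 1 2 2\<close>. They
    are computed on all of \<open>S\<close> because two of them are differentiated below.\<close>
  have chr: "christoffel X 1 1 1 y = pd 1 E y / (2 * E y)"
    "christoffel X 1 1 2 y = pd 2 E y / (2 * E y)"
    "christoffel X 1 2 1 y = pd 2 E y / (2 * E y)"
    "christoffel X 1 2 2 y = (- pd 1 G y) / (2 * E y)"
    "christoffel X 2 1 2 y = pd 1 G y / (2 * G y)"
    "christoffel X 2 2 2 y = pd 2 G y / (2 * G y)" if "y \<in> S" for y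
    using pd_offdiag[OF that]
    by (simp_all add: christoffel_def sum_2 inv[OF that] flip: E_def G_def)
  have diff2: "(\<lambda>y. 2 * E y) differentiable (at x)"
    using diff(1)[OF assms(5)] by simp
  have pd2: "pd i (\<lambda>y. 2 * E y) x = 2 * pd i E x" for i
    using has_derivative_imp_pd[OF has_derivative_mult_right[OF
          diff(1)[OF assms(5), unfolded frechet_derivative_works]]]
    by (simp add: pd_def)
  have "pd 1 (christoffel X 1 2 2) x = pd 1 (\<lambda>y. (- pd 1 G y) / (2 * E y)) x"
    by (rule pd_cong[OF assms(3,5)]) (rule chr)
  also have "\<dots> = - ((pd 1 (pd 1 G) x * (2 * E x) - pd 1 G x * (2 * pd 1 E x)) / (2 * E x * (2 * E x)))"
    using pos[OF assms(5)] diff[OF assms(5)] diff2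
    by (simp add: pd_divide pd_minus pd2)
  finally have 1: "pd 1 (christoffel X 1 2 2) x = \<dots>" .
  have "pd 2 (christoffel X 1 1 2) x = pd 2 (\<lambda>y. pd 2 E y / (2 * E y)) x"
    by (rule pd_cong[OF assms(3,5)]) (rule chr)
  also have "\<dots> = (pd 2 (pd 2 E) x * (2 * E x) - pd 2 E x * (2 * pd 2 E x)) / (2 * E x * (2 * E x))"
    using pos[OF assms(5)] diff[OF assms(5)] diff2
    by (simp add: pd_divide pd2)
  finally have 2: "pd 2 (christoffel X 1 1 2) x = \<dots>" .
  \<comment> \<open>The summand \<open>l = 2\<close> carries the vanishing off-diagonal entry, and
    the factor \<open>E x\<close> of the other cancels against the determinant
    \<open>E x * G x\<close>.\<close>
  have K: "gaussian_curvature X x = riemann X 1 1 2 2 x / G x"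
    using offdiag[OF assms(5)] offdiag'[OF assms(5)] pos[OF assms(5)]
    by (simp add: gaussian_curvature_def sum_2 det_2 E_def G_def)
  show ?thesis
    using pos[OF assms(5)]
    unfolding K riemann_def sum_2 chr[OF assms(5)] 1 2
    by (simp add: power2_eq_square add_divide_distrib diff_divide_distrib ring_distribs mult_ac)
qed

section \<open>Comparison of the two metrics of a tuple\<close>

theorem corollary6p14:
  fixes S :: "(real^2) set" and X1 X2 :: "real^2 \<Rightarrow> real^'m"
  assumes "CARD('m) > 2"
    and "open S"
    and "two_tuple_O2 S X1 X2"
  shows "\<forall>x\<in>S. gaussian_curvature X2 x = - gaussian_curvature X1 x"
proof
  fix x assume x: "x \<in> S"
  obtain e and B :: "real^2 \<Rightarrow> real^2^2" and g where
    orth_B: "\<forall>y\<in>S. orthogonal_matrix (B y)"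
    and coords: "spherical_line_of_curvature_coordinates S X1 e
        (\<lambda>y i. B y $ 1 $ i) (\<lambda>y k i. B y $ 1 $ i * g y k i)"
      "spherical_line_of_curvature_coordinates S X2 e
        (\<lambda>y i. B y $ 2 $ i) (\<lambda>y k i. B y $ 2 $ i * g y k i)"
    using assms(3) unfolding two_tuple_O2_def by blast
  have orth: "\<And>y. y \<in> S \<Longrightarrow> orthogonal_matrix (B y)"
    and I1: "\<And>y u w. y \<in> S \<Longrightarrow> first_form X1 y u w = (\<Sum>i\<in>UNIV. (B y $ 1 $ i)\<^sup>2 * (u $ i * w $ i))"
    and I2: "\<And>y u w. y \<in> S \<Longrightarrow> first_form X2 y u w = (\<Sum>i\<in>UNIV. (B y $ 2 $ i)\<^sup>2 * (u $ i * w $ i))"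
    and unit: "\<And>y. y \<in> S \<Longrightarrow> (B y $ 1 $ 1)\<^sup>2 + (B y $ 1 $ 2)\<^sup>2 = 1"
    using orth_B coords by (simp_all add: spherical_line_of_curvature_coordinates_def)
  have imm: "immersion_on S X1" "immersion_on S X2"
    using assms(3) by (simp_all add: two_tuple_O2_def)
  \<comment> \<open>Orthogonality is read as \<open>transpose (B y) ** B y = mat 1\<close>, whose
    diagonal entries are the squared lengths of the columns.\<close>
  have cols: "(B y $ 1 $ i)\<^sup>2 + (B y $ 2 $ i)\<^sup>2 = 1" if "y \<in> S" for y i
  proof -
    have "(transpose (B y) ** B y) $ i $ i = 1"
      using orth[OF that] by (simp add: orthogonal_matrix mat_def)
    then show ?thesis
      by (simp add: matrix_matrix_mult_def transpose_def sum_2 power2_eq_square)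
  qed
  define E where "E = (\<lambda>y. metric_matrix X1 y $ 1 $ 1)"
  have E: "metric_matrix X1 y $ 1 $ 1 = E y" for y
    by (simp add: E_def)
  \<comment> \<open>The first row of \<open>B y\<close> and both columns are unit vectors, so the
    squared entries are \<open>E y\<close> on the diagonal and \<open>1 - E y\<close> off it. This
    is where the spherical condition enters.\<close>
  have g1: "metric_matrix X1 y $ 1 $ 2 = 0" "metric_matrix X1 y $ 2 $ 2 = 1 - E y"
    and g2: "metric_matrix X2 y $ 1 $ 1 = 1 - E y" "metric_matrix X2 y $ 1 $ 2 = 0"
      "metric_matrix X2 y $ 2 $ 2 = E y" if "y \<in> S" for y
    using unit[OF that] cols[OF that, of 1] cols[OF that, of 2]
    by (simp_all add: E_def metric_matrix_eq_first_form I1[OF that] I2[OF that] sum_2 axis_def)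
  have diff: "E differentiable (at y)" "pd i E differentiable (at y)" if "y \<in> S" for y i
    unfolding E_def using that imm assms(2)
    by (auto simp: immersion_on_def intro: metric_matrix_differentiable pd_metric_matrix_differentiable)
  \<comment> \<open>Here \<open>h\<close> stands for the second coefficient of \<open>X1\<close> or
    the first of \<open>X2\<close>. The identity is needed at every point of \<open>S\<close> in
    order to be differentiated once more.\<close>
  have compl: "pd i h y = - pd i E y" if "\<And>y. y \<in> S \<Longrightarrow> h y = 1 - E y" "y \<in> S" for h i y
    using pd_cong[OF assms(2) that(2), of h "\<lambda>y. 1 - E y"] that diff by (simp add: pd_diff_const)
  have compl2: "pd i (pd i h) x = - pd i (pd i E) x" if "\<And>y. y \<in> S \<Longrightarrow> h y = 1 - E y" for h i
    using pd_cong[OF assms(2) x, of "pd i h" "\<lambda>y. - pd i E y"] compl[OF that] diff[OF x]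
    by (simp add: pd_minus)
  have same: "pd i (\<lambda>y. metric_matrix X2 y $ 2 $ 2) y = pd i E y" if "y \<in> S" for i y
    by (rule pd_cong[OF assms(2) that g2(3)])
  have same2: "pd i (pd i (\<lambda>y. metric_matrix X2 y $ 2 $ 2)) x = pd i (pd i E) x" for i
    by (rule pd_cong[OF assms(2) x same])
  have "gaussian_curvature X1 x = - (- pd 1 (pd 1 E) x + pd 2 (pd 2 E) x) / (2 * E x * (1 - E x))
    + (- (pd 1 E x)\<^sup>2 + (pd 2 E x)\<^sup>2) / (4 * (E x)\<^sup>2 * (1 - E x))
    + (- (pd 2 E x)\<^sup>2 + (pd 1 E x)\<^sup>2) / (4 * E x * (1 - E x)\<^sup>2)"
    using gaussian_curvature_orthogonal[OF assms(2) imm(1) x g1(1)]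
    by (simp add: compl[OF g1(2) x] compl2[OF g1(2)] g1(2)[OF x] E power2_eq_square)
  moreover have "gaussian_curvature X2 x = - (pd 1 (pd 1 E) x - pd 2 (pd 2 E) x) / (2 * E x * (1 - E x))
    + (- (pd 1 E x)\<^sup>2 + (pd 2 E x)\<^sup>2) / (4 * E x * (1 - E x)\<^sup>2)
    + (- (pd 2 E x)\<^sup>2 + (pd 1 E x)\<^sup>2) / (4 * (E x)\<^sup>2 * (1 - E x))"
    using gaussian_curvature_orthogonal[OF assms(2) imm(2) x g2(2)]
    by (simp add: compl[OF g2(1) x] compl2[OF g2(1)] same[OF x] same2 g2(1,3)[OF x]
        power2_eq_square mult_ac)
  \<comment> \<open>The same three denominators occur on both sides, the last two in exchanged
    order, with opposite numerators. Once the fractions are split, the claim is linear in the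
    resulting quotients.\<close>
  ultimately show "gaussian_curvature X2 x = - gaussian_curvature X1 x"
    by (simp only: add_divide_distrib diff_divide_distrib minus_divide_left[symmetric]
        minus_add_distrib minus_diff_eq minus_minus)
qed

end
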